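(* Let $n\ge 1$ be an integer and let $F:\mathbb{R}\to\mathbb{R}$, $U:\mathbb{R}\to\mathbb{R}$, $V:\mathbb{R}\to\mathbb{R}$, and, for $j=1,\dots,n$, $U_j,L_j,M_j,V_j:\mathbb{R}\to\mathbb{R}\cup\{\pm\infty\}$ be monotonic and right continuous functions such that: (c1) $F$ is a cumulative distribution function (cdf), and $U$ and $V$ are non-negative; (c2) $U$, $U_j$ and $M_j$ are non-decreasing and $V$, $V_j$ and $L_j$ are non-increasing, for all $j=1,\dots,n$; (c3) if $\lim_{x\to-\infty}U(x)\neq\lim_{x\to-\infty}V(x)$, then [$\lim_{x\to-\infty}U(x)=0$ or $\lim_{x\to-\infty}U_j(x)=\lim_{x\to-\infty}L_j(x)$ for all $j=1,\dots,n$] and [$\lim_{x\to-\infty}V(x)=0$ or $\lim_{x\to-\infty}M_j(x)=\lim_{x\to-\infty}V_j(x)$ for all $j=1,\dots,n$]; (c4) if $\lim_{x\to-\infty}U(x)=\lim_{x\to-\infty}V(x)\neq 0$, then $\lim_{x\to-\infty}U_j(x)=\lim_{x\to-\infty}V_j(x)$ and $\lim_{x\to-\infty}M_j(x)=\lim_{x\to-\infty}L_j(x)$ for all $j=1,\dots,n$; (c5) $\lim_{x\to-\infty}L_j(x)\le\lim_{x\to-\infty}U_j(x)$ for all $j=1,\dots,n$, and if $\lim_{x\to-\infty}V(x)\neq 0$, then $\lim_{x\to+\infty}M_j(x)\le\lim_{x\to+\infty}V_j(x)$ for all $j=1,\dots,n$; (c6) $\lim_{x\to+\infty}U_n(x)\ge\sup\{x\in\mathbb{R}:F(x)<1\}$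 and $\lim_{x\to+\infty}L_1(x)\le\inf\{x\in\mathbb{R}:F(x)>0\}$; (c7) $\lim_{x\to+\infty}U(x)=1$; (c8) $\lim_{x\to+\infty}V(x)=0$ or $\lim_{x\to+\infty}M_j(x)=\lim_{x\to+\infty}V_j(x)$ for all $j=1,\dots,n$; (c9) if $n\ge 2$, $\lim_{x\to+\infty}U_j(x)=\lim_{x\to+\infty}L_{j+1}(x)$ for all $j=1,\dots,n-1$; (c10) either $F$ has no points of discontinuity, or, for every $j$ and every $x_0\in\mathbb{R}$ such that $L_j(x_0)$ (respectively $V_j(x_0)$) is a point of discontinuity of $F$, the function $L_j$ (respectively $V_j$) is continuous at $x_0$ and constant on $[x_0,x_0+\delta)$ for some $\delta>0$. Moreover, $F$ has no point of discontinuity in the set consisting of all the limits $\lim_{x\to\pm\infty}L_j(x)$, $\lim_{x\to\pm\infty}U_j(x)$, $\lim_{x\to\pm\infty}M_j(x)$, $\lim_{x\to\pm\infty}V_j(x)$, $j=1,\dots,n$. Then $$H(x)=U(x)\sum_{j=1}^{n}\int_{L_j(x)}^{U_j(x)}dF(t)-V(x)\sum_{j=1}^{n}\int_{M_j(x)}^{V_j(x)}dF(t)$$ is a cumulative distribution function.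
   Context: A cumulative distribution function (cdf) is a non-decreasing right continuous function $F:\mathbb{R}\to\mathbb{R}$ with $\lim_{x\to-\infty}F(x)=0$ and $\lim_{x\to+\infty}F(x)=1$. Conventions: $F(-\infty)=0$, $F(+\infty)=1$, and for $a,b\in\mathbb{R}\cup\{\pm\infty\}$, $\int_a^b dF(t)=F(b)-F(a)$ (also when $a>b$). Limits, suprema, infima and right continuity of extended-real-valued functions are taken in $\mathbb{R}\cup\{\pm\infty\}$; points of discontinuity of $F$ are always real numbers. *)

theory Defs
  imports Complex_Main "HOL-Library.Extended_Real"
begin

definition right_continuous :: "(real \<Rightarrow> 'b::topological_space) \<Rightarrow> bool" where
  "right_continuous f \<longleftrightarrow> (\<forall>x. continuous (at_right x) f)"

(* A predicate on real functions; the library constant cdf instead maps a measure to its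
   distribution function. *)
definition is_cdf :: "(real \<Rightarrow> real) \<Rightarrow> bool" where
  "is_cdf F \<longleftrightarrow> mono F \<and> right_continuous F \<and> (F \<longlongrightarrow> 0) at_bot \<and> (F \<longlongrightarrow> 1) at_top"

definition ext_cdf :: "(real \<Rightarrow> real) \<Rightarrow> ereal \<Rightarrow> real" where
  "ext_cdf F y = (if y = -\<infinity> then 0 else if y = \<infinity> then 1 else F (real_of_ereal y))"

(* The integral of dF from a to b, signed: the case a > b is not set to 0. *)
definition dF_integral :: "(real \<Rightarrow> real) \<Rightarrow> ereal \<Rightarrow> ereal \<Rightarrow> real" where
  "dF_integral F a b = ext_cdf F b - ext_cdf F a"

definition discont_point :: "(real \<Rightarrow> real) \<Rightarrow> ereal \<Rightarrow> bool" where
  "discont_point F y \<longleftrightarrow> (\<exists>r. y = ereal r \<and> \<not> isCont F r)"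

(* Limits in the extended reals. Lim is a definite description, so it is meaningful only where
   the limit exists, as it does for monotone f. Real-valued functions are composed with ereal
   first: their limit may be infinite. *)
abbreviation lim_bot :: "(real \<Rightarrow> ereal) \<Rightarrow> ereal" where
  "lim_bot f \<equiv> Lim at_bot f"

abbreviation lim_top :: "(real \<Rightarrow> ereal) \<Rightarrow> ereal" where
  "lim_top f \<equiv> Lim at_top f"

end

(*
  Extend F to the extended reals by 0 and 1. All factors of H are then monotone, and their signs
  make both products monotone: the first sum is non-negative by its limit at -infinity, the second
  by its limit at +infinity. The extension is continuous at every limit of the integration bounds,
  so the limits of H can be computed termwise; at +infinity the first sum telescopes.
  The one delicate case is V unbounded at -infinity: then M_j and V_j have the same limit at
  -infinity, while lim M_j <= lim V_j at +infinity, and monotonicity in opposite directions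
  forces M_j = V_j, so the second sum vanishes identically.
*)
theory Submission imports Defs
begin

section \<open>Limits of monotone extended-real functions at both infinities\<close>

lemma mono_tendsto_Lim_at_top:
  fixes f :: "real \<Rightarrow> ereal"
  assumes "mono f"
  shows "(f \<longlongrightarrow> Lim at_top f) at_top" and "f x \<le> Lim at_top f"
proof -
  have lim: "(f \<longlongrightarrow> (SUP x. f x)) at_top"
  proof (rule increasing_tendsto)
    fix a assume "a < (SUP x. f x)"
    then obtain y where "a < f y" by (auto simp: less_SUP_iff)
    then show "\<forall>\<^sub>F x in at_top. a < f x"
      by (intro eventually_mono[OF eventually_ge_at_top[of y]])
        (rule less_le_trans[OF _ monoD[OF assms]])
  qed (simp add: SUP_upper)
  \<comment> \<open>\<open>Lim\<close> is a definite description, so its value is known only once a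
    limit has been exhibited; as a supremum it also bounds every value of \<open>f\<close>.\<close>
  then have eq: "Lim at_top f = (SUP x. f x)" by (intro tendsto_Lim) auto
  show "(f \<longlongrightarrow> Lim at_top f) at_top" using lim eq by simp
  show "f x \<le> Lim at_top f" unfolding eq by (rule SUP_upper) simp
qed

lemma mono_tendsto_Lim_at_bot:
  fixes f :: "real \<Rightarrow> ereal"
  assumes "mono f"
  shows "(f \<longlongrightarrow> Lim at_bot f) at_bot" and "Lim at_bot f \<le> f x"
proof -
  have lim: "(f \<longlongrightarrow> (INF x. f x)) at_bot"
  proof (rule decreasing_tendsto)
    fix a assume "(INF x. f x) < a"
    then obtain y where "f y < a" by (auto simp: INF_less_iff)
    then show "\<forall>\<^sub>F x in at_bot. f x < a"
      by (intro eventually_mono[OF eventually_le_at_bot[of y]])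
        (rule le_less_trans[OF monoD[OF assms]])
  qed (simp add: INF_lower)
  then have eq: "Lim at_bot f = (INF x. f x)" by (intro tendsto_Lim) auto
  show "(f \<longlongrightarrow> Lim at_bot f) at_bot" using lim eq by simp
  show "Lim at_bot f \<le> f x" unfolding eq by (rule INF_lower) simp
qed

lemma antimono_tendsto_Lim_at_top:
  fixes f :: "real \<Rightarrow> ereal"
  assumes "antimono f"
  shows "(f \<longlongrightarrow> Lim at_top f) at_top" and "Lim at_top f \<le> f x"
proof -
  have lim: "(f \<longlongrightarrow> (INF x. f x)) at_top"
  proof (rule decreasing_tendsto)
    fix a assume "(INF x. f x) < a"
    then obtain y where "f y < a" by (auto simp: INF_less_iff)
    then show "\<forall>\<^sub>F x in at_top. f x < a"
      by (intro eventually_mono[OF eventually_ge_at_top[of y]])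
        (rule le_less_trans[OF antimonoD[OF assms]])
  qed (simp add: INF_lower)
  then have eq: "Lim at_top f = (INF x. f x)" by (intro tendsto_Lim) auto
  show "(f \<longlongrightarrow> Lim at_top f) at_top" using lim eq by simp
  show "Lim at_top f \<le> f x" unfolding eq by (rule INF_lower) simp
qed

lemma antimono_tendsto_Lim_at_bot:
  fixes f :: "real \<Rightarrow> ereal"
  assumes "antimono f"
  shows "(f \<longlongrightarrow> Lim at_bot f) at_bot" and "f x \<le> Lim at_bot f"
proof -
  have lim: "(f \<longlongrightarrow> (SUP x. f x)) at_bot"
  proof (rule increasing_tendsto)
    fix a assume "a < (SUP x. f x)"
    then obtain y where "a < f y" by (auto simp: less_SUP_iff)
    then show "\<forall>\<^sub>F x in at_bot. a < f x"
      by (intro eventually_mono[OF eventually_le_at_bot[of y]])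
        (rule less_le_trans[OF _ antimonoD[OF assms]])
  qed (simp add: SUP_upper)
  then have eq: "Lim at_bot f = (SUP x. f x)" by (intro tendsto_Lim) auto
  show "(f \<longlongrightarrow> Lim at_bot f) at_bot" using lim eq by simp
  show "f x \<le> Lim at_bot f" unfolding eq by (rule SUP_upper) simp
qed

section \<open>The extension of a cdf to the extended reals\<close>

lemma ext_cdf_simps [simp]:
  "ext_cdf F (ereal r) = F r" "ext_cdf F \<infinity> = 1" "ext_cdf F (-\<infinity>) = 0"
  by (simp_all add: ext_cdf_def)

lemma is_cdf_nonneg:
  assumes "is_cdf F"
  shows "0 \<le> F x"
proof (rule tendsto_upperbound)
  show "(F \<longlongrightarrow> 0) at_bot" using assms by (simp add: is_cdf_def)
  show "\<forall>\<^sub>F y in at_bot. F y \<le> F x"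
    using assms by (intro eventually_mono[OF eventually_le_at_bot[of x]])
      (auto simp: is_cdf_def dest: monoD)
qed simp

lemma is_cdf_le_1:
  assumes "is_cdf F"
  shows "F x \<le> 1"
proof (rule tendsto_lowerbound)
  show "(F \<longlongrightarrow> 1) at_top" using assms by (simp add: is_cdf_def)
  show "\<forall>\<^sub>F y in at_top. F x \<le> F y"
    using assms by (intro eventually_mono[OF eventually_ge_at_top[of x]])
      (auto simp: is_cdf_def dest: monoD)
qed simp

lemma ext_cdf_mono:
  assumes "is_cdf F" "a \<le> b"
  shows "ext_cdf F a \<le> ext_cdf F b"
  using assms is_cdf_nonneg[of F] is_cdf_le_1[of F]
  by (cases a; cases b) (auto simp: is_cdf_def dest: monoD)

text \<open>At the two infinities continuity is just the pair of limits in the definition of a cdf;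
  near a real point the extension is \<open>F\<close> composed with
  \<open>real_of_ereal\<close>.\<close>

lemma isCont_ext_cdf:
  assumes F: "is_cdf F" and y: "\<not> discont_point F y"
  shows "isCont (ext_cdf F) y"
proof (cases y)
  case (real r)
  have "isCont F r" using y real by (auto simp: discont_point_def)
  moreover have "(real_of_ereal \<longlongrightarrow> r) (at (ereal r))"
    by (rule lim_real_of_ereal) (simp add: tendsto_ident_at)
  ultimately have "((\<lambda>z. F (real_of_ereal z)) \<longlongrightarrow> F r) (at (ereal r))"
    by (rule isCont_tendsto_compose)
  moreover have "\<forall>\<^sub>F z in at (ereal r). F (real_of_ereal z) = ext_cdf F z"
  proof -
    \<comment> \<open>Keeping both infinities away from \<open>z\<close> leaves only the last branch
      of \<open>ext_cdf\<close>.\<close>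
    have "\<forall>\<^sub>F z in at (ereal r). -\<infinity> < z" "\<forall>\<^sub>F z in at (ereal r). z < \<infinity>"
      by (rule order_tendstoD[OF tendsto_ident_at]; simp)+
    then show ?thesis by eventually_elim (auto simp: ext_cdf_def)
  qed
  ultimately have "(ext_cdf F \<longlongrightarrow> F r) (at (ereal r))"
    by (rule Lim_transform_eventually)
  then show ?thesis by (simp add: real isCont_def)
next
  case PInf
  have "(ext_cdf F \<longlongrightarrow> 1) (at \<infinity>)"
  proof (rule increasing_tendsto)
    have "ext_cdf F z \<le> 1" for z
      using ext_cdf_mono[OF F, of z \<infinity>] by simp
    then show "\<forall>\<^sub>F z in at \<infinity>. ext_cdf F z \<le> 1" by simp
    fix a :: real assume "a < 1"
    then have "\<forall>\<^sub>F x in at_top. a < F x"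
      using F by (auto simp: is_cdf_def intro: order_tendstoD)
    then obtain x where x: "a < F x" by (auto simp: eventually_at_top_linorder)
    \<comment> \<open>One real \<open>x\<close> with \<open>a < F x\<close> suffices: monotonicity
      of the extension covers every \<open>z\<close> above it.\<close>
    have "\<forall>\<^sub>F z in at \<infinity>. ereal x < z"
      by (rule order_tendstoD[OF tendsto_ident_at]) simp
    then show "\<forall>\<^sub>F z in at \<infinity>. a < ext_cdf F z"
    proof eventually_elim
      case (elim z)
      then show ?case using x ext_cdf_mono[OF F less_imp_le[OF elim]] by simp
    qed
  qed
  then show ?thesis by (simp add: PInf isCont_def)
next
  case MInf
  have "(ext_cdf F \<longlongrightarrow> 0) (at (-\<infinity>))"
  proof (rule decreasing_tendsto)
    have "0 \<le> ext_cdf F z" for z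
      using ext_cdf_mono[OF F, of "-\<infinity>" z] by simp
    then show "\<forall>\<^sub>F z in at (-\<infinity>). 0 \<le> ext_cdf F z" by simp
    fix a :: real assume "0 < a"
    then have "\<forall>\<^sub>F x in at_bot. F x < a"
      using F by (auto simp: is_cdf_def intro: order_tendstoD)
    then obtain x where x: "F x < a" by (auto simp: eventually_at_bot_linorder)
    have "\<forall>\<^sub>F z in at (-\<infinity>). z < ereal x"
      by (rule order_tendstoD[OF tendsto_ident_at]) simp
    then show "\<forall>\<^sub>F z in at (-\<infinity>). ext_cdf F z < a"
    proof eventually_elim
      case (elim z)
      then show ?case using x ext_cdf_mono[OF F less_imp_le[OF elim]] by simp
    qed
  qed
  then show ?thesis by (simp add: MInf isCont_def)
qed

section \<open>Composition of the extended cdf with the integration bounds\<close>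

lemma tendsto_ext_cdf:
  assumes "is_cdf F" "\<not> discont_point F l" "(f \<longlongrightarrow> l) G"
  shows "((\<lambda>x. ext_cdf F (f x)) \<longlongrightarrow> ext_cdf F l) G"
  by (rule isCont_tendsto_compose[OF isCont_ext_cdf[OF assms(1,2)] assms(3)])

text \<open>A non-decreasing \<open>f\<close> approaches \<open>f x\<close> from above as its
  argument decreases to \<open>x\<close>, so right continuity of \<open>F\<close> suffices even at a
  jump. Serves the bounds \<open>Us j\<close> and \<open>Ms j\<close>.\<close>

lemma right_continuous_ext_cdf_mono:
  assumes F: "is_cdf F" and f: "mono f" "right_continuous f"
  shows "right_continuous (\<lambda>x. ext_cdf F (f x))"
  unfolding right_continuous_def
proof
  fix x
  have lim: "(f \<longlongrightarrow> f x) (at_right x)"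
    using f by (simp add: right_continuous_def continuous_within)
  show "continuous (at_right x) (\<lambda>x. ext_cdf F (f x))"
    unfolding continuous_within
  proof (cases "f x")
    case (real r)
    show "((\<lambda>x. ext_cdf F (f x)) \<longlongrightarrow> ext_cdf F (f x)) (at_right x)"
    proof (rule decreasing_tendsto)
      show "\<forall>\<^sub>F z in at_right x. ext_cdf F (f x) \<le> ext_cdf F (f z)"
        using f(1) by (intro eventually_mono[OF eventually_at_right_less])
          (auto intro!: ext_cdf_mono[OF F] monoD[OF f(1)])
      fix a assume "ext_cdf F (f x) < a"
      then have "F r < a" using real by simp
      moreover have "(F \<longlongrightarrow> F r) (at_right r)"
        using F by (simp add: is_cdf_def right_continuous_def continuous_within)
      ultimately have "\<forall>\<^sub>F s in at_right r. F s < a" by (auto intro: order_tendstoD)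
      \<comment> \<open>The strict inequality \<open>r < s\<close> leaves room above
        \<open>f x\<close>, so that \<open>f z < ereal s\<close> holds for all \<open>z\<close> just
        right of \<open>x\<close>.\<close>
      then have "\<forall>\<^sub>F s in at_right r. r < s \<and> F s < a"
        using eventually_at_right_less[of r] by eventually_elim auto
      then obtain s where s: "r < s" "F s < a"
        using eventually_happens'[OF trivial_limit_at_right_real] by blast
      have "\<forall>\<^sub>F z in at_right x. f z < ereal s"
        using lim real s by (auto intro: order_tendstoD)
      then show "\<forall>\<^sub>F z in at_right x. ext_cdf F (f z) < a"
      proof eventually_elim
        case (elim z)
        then show ?case using s ext_cdf_mono[OF F less_imp_le[OF elim]] by simp
      qed
    qed
  \<comment> \<open>An infinite value of \<open>f x\<close> is never a discontinuity point, so full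
    continuity of the extension applies.\<close>
  qed (rule tendsto_ext_cdf[OF F _ lim], simp add: discont_point_def)+
qed

text \<open>Meant for the non-increasing bounds \<open>Ls j\<close> and \<open>Vs j\<close>, which
  may approach a jump of \<open>F\<close> from below, where right continuity of \<open>F\<close>
  gives nothing; local constancy to the right replaces it there.\<close>

lemma right_continuous_ext_cdf_locally_constant:
  assumes F: "is_cdf F" and f: "right_continuous f"
    and const: "\<And>x. discont_point F (f x) \<Longrightarrow> \<exists>\<delta>>0. \<forall>z\<in>{x..<x + \<delta>}. f z = f x"
  shows "right_continuous (\<lambda>x. ext_cdf F (f x))"
  unfolding right_continuous_def
proof
  fix x
  have lim: "(f \<longlongrightarrow> f x) (at_right x)"
    using f by (simp add: right_continuous_def continuous_within)
  show "continuous (at_right x) (\<lambda>x. ext_cdf F (f x))"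
    unfolding continuous_within
  proof (cases "discont_point F (f x)")
    case True
    then obtain d where d: "d > 0" "\<forall>z\<in>{x..<x + d}. f z = f x" using const by blast
    have "\<forall>\<^sub>F z in at_right x. z \<in> {x<..<x + d}"
      using d by (intro eventually_at_right_real) simp
    then have "\<forall>\<^sub>F z in at_right x. ext_cdf F (f z) = ext_cdf F (f x)"
    proof eventually_elim
      case (elim z)
      then have "z \<in> {x..<x + d}" by auto
      with d(2) have "f z = f x" by (rule bspec)
      then show ?case by simp
    qed
    then show "((\<lambda>x. ext_cdf F (f x)) \<longlongrightarrow> ext_cdf F (f x)) (at_right x)"
      by (rule tendsto_eventually)
  qed (auto intro!: tendsto_ext_cdf[OF F _ lim])
qed

section \<open>Values of the extended cdf beyond the ends of the range where it varies\<close>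

lemma ext_cdf_eq_1:
  assumes F: "is_cdf F" and y: "Sup (ereal ` {x. F x < 1}) \<le> y"
  shows "ext_cdf F y = 1"
proof (cases y)
  case (real r)
  have "(F \<longlongrightarrow> F r) (at_right r)"
    using F by (simp add: is_cdf_def right_continuous_def continuous_within)
  \<comment> \<open>Strictly right of \<open>r\<close> the function \<open>F\<close> is 1, and right
    continuity carries this value to \<open>r\<close> itself.\<close>
  moreover have "\<forall>\<^sub>F s in at_right r. F s = 1"
    using eventually_at_right_less[of r]
  proof eventually_elim
    case (elim s)
    have "\<not> F s < 1"
    proof
      assume "F s < 1"
      then have "ereal s \<le> y" using y by (simp add: Sup_le_iff)
      then show False using elim real by simp
    qed
    then show ?case using is_cdf_le_1[OF F, of s] by simp
  qed
  then have "(F \<longlongrightarrow> 1) (at_right r)" by (rule tendsto_eventually)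
  ultimately have "F r = 1" by (rule tendsto_unique[OF trivial_limit_at_right_real])
  then show ?thesis by (simp add: real)
next
  case MInf
  have "\<forall>\<^sub>F x in at_bot. F x < 1"
    using F by (auto simp: is_cdf_def intro: order_tendstoD)
  then obtain x where "F x < 1" by (auto simp: eventually_at_bot_linorder)
  then have "ereal x \<le> y" using y by (simp add: Sup_le_iff)
  then show ?thesis using MInf by simp
qed simp

text \<open>Left of \<open>y\<close> the function \<open>F\<close> vanishes, but a jump could make
  it positive at \<open>y\<close>; continuity there passes the value 0 on to
  \<open>y\<close>.\<close>

lemma ext_cdf_eq_0:
  assumes F: "is_cdf F" and y: "y \<le> Inf (ereal ` {x. 0 < F x})"
    and cont: "\<not> discont_point F y"
  shows "ext_cdf F y = 0"
proof (cases y)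
  case (real r)
  have "(F \<longlongrightarrow> F r) (at_left r)"
    using cont real by (simp add: discont_point_def isCont_def filterlim_at_split)
  moreover have "\<forall>\<^sub>F s in at_left r. F s = 0"
    \<comment> \<open>The lower end \<open>r - 1\<close> is arbitrary; only \<open>s < r\<close>
      matters.\<close>
    using eventually_at_left_real[of "r - 1" r, simplified]
  proof eventually_elim
    case (elim s)
    have "\<not> 0 < F s"
    proof
      assume "0 < F s"
      then have "y \<le> ereal s" using y by (simp add: le_Inf_iff)
      then show False using elim real by simp
    qed
    then show ?case using is_cdf_nonneg[OF F, of s] by simp
  qed
  then have "(F \<longlongrightarrow> 0) (at_left r)" by (rule tendsto_eventually)
  ultimately have "F r = 0" by (rule tendsto_unique[OF trivial_limit_at_left_real])
  then show ?thesis by (simp add: real)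
next
  case PInf
  have "\<forall>\<^sub>F x in at_top. 0 < F x"
    using F by (auto simp: is_cdf_def intro: order_tendstoD)
  then obtain x where "0 < F x" by (auto simp: eventually_at_top_linorder)
  then have "y \<le> ereal x" using y by (simp add: le_Inf_iff)
  then show ?thesis using PInf by simp
qed simp

theorem theorem1:
  fixes n :: nat
    and F U V :: "real \<Rightarrow> real"
    and Us Ls Ms Vs :: "nat \<Rightarrow> real \<Rightarrow> ereal"
  assumes n: "n \<ge> 1"
    and rc: "right_continuous F" "right_continuous U" "right_continuous V"
      "\<forall>j\<in>{1..n}. right_continuous (Us j) \<and> right_continuous (Ls j)
                 \<and> right_continuous (Ms j) \<and> right_continuous (Vs j)"
    and c1: "is_cdf F" "\<forall>x. U x \<ge> 0" "\<forall>x. V x \<ge> 0"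
    and c2: "mono U" "\<forall>j\<in>{1..n}. mono (Us j) \<and> mono (Ms j)"
      "antimono V" "\<forall>j\<in>{1..n}. antimono (Vs j) \<and> antimono (Ls j)"
    and c3: "lim_bot (\<lambda>x. ereal (U x)) \<noteq> lim_bot (\<lambda>x. ereal (V x)) \<longrightarrow>
        (lim_bot (\<lambda>x. ereal (U x)) = 0 \<or> (\<forall>j\<in>{1..n}. lim_bot (Us j) = lim_bot (Ls j))) \<and>
        (lim_bot (\<lambda>x. ereal (V x)) = 0 \<or> (\<forall>j\<in>{1..n}. lim_bot (Ms j) = lim_bot (Vs j)))"
    and c4: "lim_bot (\<lambda>x. ereal (U x)) = lim_bot (\<lambda>x. ereal (V x)) \<and>
        lim_bot (\<lambda>x. ereal (V x)) \<noteq> 0 \<longrightarrow>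
        (\<forall>j\<in>{1..n}. lim_bot (Us j) = lim_bot (Vs j) \<and> lim_bot (Ms j) = lim_bot (Ls j))"
    and c5: "\<forall>j\<in>{1..n}. lim_bot (Ls j) \<le> lim_bot (Us j)"
      "lim_bot (\<lambda>x. ereal (V x)) \<noteq> 0 \<longrightarrow> (\<forall>j\<in>{1..n}. lim_top (Ms j) \<le> lim_top (Vs j))"
    and c6: "lim_top (Us n) \<ge> Sup (ereal ` {x. F x < 1})"
      "lim_top (Ls 1) \<le> Inf (ereal ` {x. F x > 0})"
    and c7: "lim_top (\<lambda>x. ereal (U x)) = 1"
    and c8: "lim_top (\<lambda>x. ereal (V x)) = 0 \<or> (\<forall>j\<in>{1..n}. lim_top (Ms j) = lim_top (Vs j))"
    and c9: "n \<ge> 2 \<longrightarrow> (\<forall>j\<in>{1..n - 1}. lim_top (Us j) = lim_top (Ls (j + 1)))"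
    and c10: "(\<forall>x. \<not> discont_point F (ereal x)) \<or>
        (\<forall>j\<in>{1..n}. \<forall>f\<in>{Ls j, Vs j}. \<forall>x0. discont_point F (f x0) \<longrightarrow>
           isCont f x0 \<and> (\<exists>\<delta>>0. \<forall>x\<in>{x0..<x0 + \<delta>}. f x = f x0))"
      "\<forall>j\<in>{1..n}. \<forall>f\<in>{Ls j, Us j, Ms j, Vs j}.
          \<not> discont_point F (lim_bot f) \<and> \<not> discont_point F (lim_top f)"
  shows "is_cdf (\<lambda>x. U x * (\<Sum>j=1..n. dF_integral F (Ls j x) (Us j x))
                   - V x * (\<Sum>j=1..n. dF_integral F (Ms j x) (Vs j x)))"
proof -

  \<comment> \<open>Signs and monotonicity of the two products\<close>
  define A where "A x = (\<Sum>j=1..n. dF_integral F (Ls j x) (Us j x))" for x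
  define B where "B x = (\<Sum>j=1..n. dF_integral F (Ms j x) (Vs j x))" for x

  note F = \<open>is_cdf F\<close>
  have mU: "mono (\<lambda>x. ereal (U x))" and mV: "antimono (\<lambda>x. ereal (V x))"
    using c2(1,3) by (auto simp: mono_def antimono_def)
  have m: "mono (Us j)" "mono (Ms j)" "antimono (Vs j)" "antimono (Ls j)"
    if "j \<in> {1..n}" for j
    using c2 that by blast+
  \<comment> \<open>The two bounds move apart from their limits at -infinity, so the order there,
    given by \<open>c5\<close>, persists everywhere.\<close>
  have bounds: "Ls j x \<le> Us j x" if j: "j \<in> {1..n}" for j x
  proof -
    have "Ls j x \<le> lim_bot (Ls j)" by (rule antimono_tendsto_Lim_at_bot(2)[OF m(4)[OF j]])
    also have "\<dots> \<le> lim_bot (Us j)" using c5 j by blast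
    also have "\<dots> \<le> Us j x" by (rule mono_tendsto_Lim_at_bot(2)[OF m(1)[OF j]])
    finally show ?thesis .
  qed
  have V_le: "ereal (V x) \<le> lim_bot (\<lambda>x. ereal (V x))" for x
    by (rule antimono_tendsto_Lim_at_bot(2)[OF mV])
  \<comment> \<open>A non-negative, non-increasing function with limit 0 at -infinity is zero. This
    covers the case in which \<open>c5\<close> does not order \<open>Ms j\<close> and
    \<open>Vs j\<close>.\<close>
  have V_zero: "V x = 0" if "lim_bot (\<lambda>x. ereal (V x)) = 0" for x
  proof -
    have "V x \<le> 0" using V_le[of x] that by (simp flip: zero_ereal_def)
    then show ?thesis using c1(3) by (simp add: order_antisym)
  qed
  \<comment> \<open>Here the bounds move towards each other, so it is the order at +infinity that
    propagates backwards.\<close>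
  have bounds': "Ms j x \<le> Vs j x"
    if "lim_bot (\<lambda>x. ereal (V x)) \<noteq> 0" and j: "j \<in> {1..n}" for j x
  proof -
    have "Ms j x \<le> lim_top (Ms j)" by (rule mono_tendsto_Lim_at_top(2)[OF m(2)[OF j]])
    also have "\<dots> \<le> lim_top (Vs j)" using c5(2) that by blast
    also have "\<dots> \<le> Vs j x" by (rule antimono_tendsto_Lim_at_top(2)[OF m(3)[OF j]])
    finally show ?thesis .
  qed

  have A_nonneg: "0 \<le> A x" for x
    unfolding A_def dF_integral_def
    by (intro sum_nonneg) (simp add: ext_cdf_mono[OF F] bounds)
  \<comment> \<open>As \<open>x\<close> grows, both ends of each integral in \<open>A\<close> move
    outward; those in \<open>B\<close> move inward.\<close>
  have A_mono: "A x \<le> A y" if "x \<le> y" for x y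
    unfolding A_def dF_integral_def
    by (intro sum_mono diff_mono ext_cdf_mono[OF F] monoD[OF m(1)] antimonoD[OF m(4)] that)
  have B_nonneg: "0 \<le> B x" if "lim_bot (\<lambda>x. ereal (V x)) \<noteq> 0" for x
    unfolding B_def dF_integral_def
    by (intro sum_nonneg) (simp add: ext_cdf_mono[OF F] bounds'[OF that])
  have B_antimono: "B y \<le> B x" if "x \<le> y" for x y
    unfolding B_def dF_integral_def
    by (intro sum_mono diff_mono ext_cdf_mono[OF F] monoD[OF m(2)] antimonoD[OF m(3)] that)

  have H_mono: "mono (\<lambda>x. U x * A x - V x * B x)"
  proof (rule monoI)
    fix x y :: real assume xy: "x \<le> y"
    have "U x * A x \<le> U y * A y"
      using xy c1 by (intro mult_mono A_mono A_nonneg monoD[OF c2(1)]) auto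
    moreover have "V y * B y \<le> V x * B x"
    \<comment> \<open>If this limit is 0, the sign of \<open>B\<close> is unknown, but the product
      vanishes; otherwise all factors are non-negative.\<close>
    proof (cases "lim_bot (\<lambda>x. ereal (V x)) = 0")
      case True
      then show ?thesis by (simp add: V_zero[OF True])
    next
      case False
      then show ?thesis
        using xy c1 by (intro mult_mono B_antimono B_nonneg antimonoD[OF c2(3)]) auto
    qed
    ultimately show "U x * A x - V x * B x \<le> U y * A y - V y * B y" by simp
  qed

  \<comment> \<open>Right continuity of \<open>H\<close>\<close>
  have const: "\<exists>\<delta>>0. \<forall>z\<in>{x..<x + \<delta>}. f z = f x"
    if "j \<in> {1..n}" "f \<in> {Ls j, Vs j}" "discont_point F (f x)" for j f x
  proof -
    \<comment> \<open>A jump of \<open>F\<close> at \<open>f x\<close> rules out the first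
      alternative of \<open>c10\<close>, which leaves local constancy.\<close>
    have "\<not> (\<forall>x. \<not> discont_point F (ereal x))"
      using that(3) unfolding discont_point_def by blast
    then show ?thesis using c10(1) that by blast
  qed
  have rcs: "right_continuous (\<lambda>x. ext_cdf F (Us j x))"
    "right_continuous (\<lambda>x. ext_cdf F (Ms j x))"
    "right_continuous (\<lambda>x. ext_cdf F (Ls j x))"
    "right_continuous (\<lambda>x. ext_cdf F (Vs j x))" if j: "j \<in> {1..n}" for j
  proof -
    show "right_continuous (\<lambda>x. ext_cdf F (Us j x))" "right_continuous (\<lambda>x. ext_cdf F (Ms j x))"
      by (rule right_continuous_ext_cdf_mono[OF F]; use rc(4) m[OF j] j in blast)+
    show "right_continuous (\<lambda>x. ext_cdf F (Ls j x))" "right_continuous (\<lambda>x. ext_cdf F (Vs j x))"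
      by (rule right_continuous_ext_cdf_locally_constant[OF F _ const[OF j]]; use rc(4) j in blast)+
  qed
  have H_rc: "right_continuous (\<lambda>x. U x * A x - V x * B x)"
    using rc(2,3) rcs unfolding right_continuous_def A_def B_def dF_integral_def
    by (auto intro!: continuous_intros)

  \<comment> \<open>Termwise limits of the two sums\<close>
  have not_disc: "\<not> discont_point F (lim_bot f)" "\<not> discont_point F (lim_top f)"
    if "j \<in> {1..n}" "f \<in> {Ls j, Us j, Ms j, Vs j}" for j f
    using c10(2) that by blast+
  have ext_lim_bot:
    "((\<lambda>x. ext_cdf F (Us j x)) \<longlongrightarrow> ext_cdf F (lim_bot (Us j))) at_bot"
    "((\<lambda>x. ext_cdf F (Ms j x)) \<longlongrightarrow> ext_cdf F (lim_bot (Ms j))) at_bot"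
    "((\<lambda>x. ext_cdf F (Vs j x)) \<longlongrightarrow> ext_cdf F (lim_bot (Vs j))) at_bot"
    "((\<lambda>x. ext_cdf F (Ls j x)) \<longlongrightarrow> ext_cdf F (lim_bot (Ls j))) at_bot"
    if j: "j \<in> {1..n}" for j
    by (rule tendsto_ext_cdf[OF F not_disc(1)[OF j] mono_tendsto_Lim_at_bot(1)[OF m(1)[OF j]]]
        tendsto_ext_cdf[OF F not_disc(1)[OF j] mono_tendsto_Lim_at_bot(1)[OF m(2)[OF j]]]
        tendsto_ext_cdf[OF F not_disc(1)[OF j] antimono_tendsto_Lim_at_bot(1)[OF m(3)[OF j]]]
        tendsto_ext_cdf[OF F not_disc(1)[OF j] antimono_tendsto_Lim_at_bot(1)[OF m(4)[OF j]]]; simp)+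
  have ext_lim_top:
    "((\<lambda>x. ext_cdf F (Us j x)) \<longlongrightarrow> ext_cdf F (lim_top (Us j))) at_top"
    "((\<lambda>x. ext_cdf F (Ms j x)) \<longlongrightarrow> ext_cdf F (lim_top (Ms j))) at_top"
    "((\<lambda>x. ext_cdf F (Vs j x)) \<longlongrightarrow> ext_cdf F (lim_top (Vs j))) at_top"
    "((\<lambda>x. ext_cdf F (Ls j x)) \<longlongrightarrow> ext_cdf F (lim_top (Ls j))) at_top"
    if j: "j \<in> {1..n}" for j
    by (rule tendsto_ext_cdf[OF F not_disc(2)[OF j] mono_tendsto_Lim_at_top(1)[OF m(1)[OF j]]]
        tendsto_ext_cdf[OF F not_disc(2)[OF j] mono_tendsto_Lim_at_top(1)[OF m(2)[OF j]]]
        tendsto_ext_cdf[OF F not_disc(2)[OF j] antimono_tendsto_Lim_at_top(1)[OF m(3)[OF j]]]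
        tendsto_ext_cdf[OF F not_disc(2)[OF j] antimono_tendsto_Lim_at_top(1)[OF m(4)[OF j]]]; simp)+
  have A_bot: "(A \<longlongrightarrow> (\<Sum>j=1..n. dF_integral F (lim_bot (Ls j)) (lim_bot (Us j)))) at_bot"
    unfolding A_def dF_integral_def by (intro tendsto_sum tendsto_diff ext_lim_bot)
  have B_bot: "(B \<longlongrightarrow> (\<Sum>j=1..n. dF_integral F (lim_bot (Ms j)) (lim_bot (Vs j)))) at_bot"
    unfolding B_def dF_integral_def by (intro tendsto_sum tendsto_diff ext_lim_bot)
  have A_top: "(A \<longlongrightarrow> (\<Sum>j=1..n. dF_integral F (lim_top (Ls j)) (lim_top (Us j)))) at_top"
    unfolding A_def dF_integral_def by (intro tendsto_sum tendsto_diff ext_lim_top)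
  have B_top: "(B \<longlongrightarrow> (\<Sum>j=1..n. dF_integral F (lim_top (Ms j)) (lim_top (Vs j)))) at_top"
    unfolding B_def dF_integral_def by (intro tendsto_sum tendsto_diff ext_lim_top)

  \<comment> \<open>The limit of \<open>H\<close> at +infinity\<close>
  have A_top_eq: "(\<Sum>j=1..n. dF_integral F (lim_top (Ls j)) (lim_top (Us j))) = 1"
  proof -
    \<comment> \<open>Telescoping by induction on the number of terms, starting at
      \<open>k = 1\<close> so that the end \<open>Ls 1\<close> is already present. At
      \<open>k = n\<close>, \<open>c6\<close> gives the two remaining values 1 and 0.\<close>
    have "(\<Sum>j=1..k. dF_integral F (lim_top (Ls j)) (lim_top (Us j)))
        = ext_cdf F (lim_top (Us k)) - ext_cdf F (lim_top (Ls 1))" if "1 \<le> k" "k \<le> n" for k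
      using that
    proof (induction k rule: dec_induct)
      case base
      then show ?case by (simp add: dF_integral_def)
    next
      case (step k)
      \<comment> \<open>The inductive step needs \<open>k < n\<close>, exactly the range of
        \<open>c9\<close>, and together with \<open>1 \<le> k\<close> this gives
        \<open>n \<ge> 2\<close>.\<close>
      have "lim_top (Us k) = lim_top (Ls (Suc k))" using c9 step by simp
      then show ?case using step by (simp add: dF_integral_def)
    qed
    from this[OF n order_refl] show ?thesis
      using ext_cdf_eq_1[OF F c6(1)] ext_cdf_eq_0[OF F c6(2)] not_disc(2)[of 1 "Ls 1"] n
      by simp
  qed

  have U_top: "(U \<longlongrightarrow> 1) at_top"
    using mono_tendsto_Lim_at_top(1)[OF mU] c7 by (simp add: one_ereal_def)
  have "0 \<le> lim_top (\<lambda>x. ereal (V x))"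
    by (rule tendsto_lowerbound[OF antimono_tendsto_Lim_at_top(1)[OF mV]]) (simp_all add: c1)
  \<comment> \<open>The limit is finite, lying between 0 and the sample value
    \<open>V 0\<close>.\<close>
  then obtain v where v: "lim_top (\<lambda>x. ereal (V x)) = ereal v"
    using antimono_tendsto_Lim_at_top(2)[OF mV, of 0]
    by (cases "lim_top (\<lambda>x. ereal (V x))") auto
  have V_top: "(V \<longlongrightarrow> v) at_top"
    using antimono_tendsto_Lim_at_top(1)[OF mV] v by simp
  \<comment> \<open>By \<open>c8\<close>, either \<open>v\<close> is 0 or every integral has equal
    endpoints.\<close>
  have "v * (\<Sum>j=1..n. dF_integral F (lim_top (Ms j)) (lim_top (Vs j))) = 0"
    using c8 v by (auto simp: dF_integral_def)
  with tendsto_diff[OF tendsto_mult[OF U_top A_top] tendsto_mult[OF V_top B_top]]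
  have H_top: "((\<lambda>x. U x * A x - V x * B x) \<longlongrightarrow> 1) at_top"
    by (simp only: A_top_eq mult_1_left diff_zero)

  \<comment> \<open>The limit of \<open>H\<close> at -infinity\<close>
  have "0 \<le> lim_bot (\<lambda>x. ereal (U x))"
    by (rule tendsto_lowerbound[OF mono_tendsto_Lim_at_bot(1)[OF mU]]) (simp_all add: c1)
  \<comment> \<open>The limit of \<open>U\<close> lies between 0 and \<open>U 0\<close>; no such
    upper bound is available for \<open>V\<close>.\<close>
  then obtain u where u: "lim_bot (\<lambda>x. ereal (U x)) = ereal u"
    using mono_tendsto_Lim_at_bot(2)[OF mU, of 0]
    by (cases "lim_bot (\<lambda>x. ereal (U x))") auto
  have U_bot: "(U \<longlongrightarrow> u) at_bot"
    using mono_tendsto_Lim_at_bot(1)[OF mU] u by simp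
  note UA_bot = tendsto_mult[OF U_bot A_bot]
  have H_bot: "((\<lambda>x. U x * A x - V x * B x) \<longlongrightarrow> 0) at_bot"
  proof (cases "lim_bot (\<lambda>x. ereal (U x)) = lim_bot (\<lambda>x. ereal (V x))")
    case True
    have "(V \<longlongrightarrow> u) at_bot"
      using antimono_tendsto_Lim_at_bot(1)[OF mV] u True by simp
    note lim = tendsto_diff[OF UA_bot tendsto_mult[OF this B_bot]]
    \<comment> \<open>In this case \<open>V\<close> inherits the finite limit \<open>u\<close>. If
      it is nonzero, \<open>c4\<close> matches the endpoints of the two sums, so the limits of the
      products cancel.\<close>
    have "u * (\<Sum>j=1..n. dF_integral F (lim_bot (Ls j)) (lim_bot (Us j)))
        = u * (\<Sum>j=1..n. dF_integral F (lim_bot (Ms j)) (lim_bot (Vs j)))"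
    proof (cases "u = 0")
      case False
      then have "lim_bot (\<lambda>x. ereal (V x)) \<noteq> 0" using u True by (metis ereal_eq_0(1))
      then have "\<forall>j\<in>{1..n}. lim_bot (Us j) = lim_bot (Vs j) \<and> lim_bot (Ms j) = lim_bot (Ls j)"
        using c4 True by blast
      then show ?thesis by simp
    qed simp
    with lim show ?thesis by (simp only: diff_self)
  next
    case False
    \<comment> \<open>The first half of \<open>c3\<close>: either \<open>u\<close> is 0 or each
      integral has equal endpoints.\<close>
    have "u * (\<Sum>j=1..n. dF_integral F (lim_bot (Ls j)) (lim_bot (Us j))) = 0"
      using c3 False u by (auto simp: dF_integral_def)
    with UA_bot have "((\<lambda>x. U x * A x) \<longlongrightarrow> 0) at_bot" by (simp only:)
    \<comment> \<open>The product rule for limits fails if \<open>V\<close> is unbounded, so the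
      product is shown to vanish at every point, for any nonzero limit of \<open>V\<close>, finite
      or not.\<close>
    moreover have "V x * B x = 0" for x
    proof (cases "lim_bot (\<lambda>x. ereal (V x)) = 0")
      case True
      then show ?thesis by (simp add: V_zero[OF True])
    next
      case V: False
      have "Ms j x = Vs j x" if j: "j \<in> {1..n}" for j
      proof (rule antisym)
        have "Vs j x \<le> lim_bot (Vs j)" by (rule antimono_tendsto_Lim_at_bot(2)[OF m(3)[OF j]])
        also have "\<dots> = lim_bot (Ms j)" using c3 False V j by simp
        also have "\<dots> \<le> Ms j x" by (rule mono_tendsto_Lim_at_bot(2)[OF m(2)[OF j]])
        finally show "Vs j x \<le> Ms j x" .
      qed (rule bounds'[OF V j])
      then show ?thesis by (simp add: B_def dF_integral_def)
    qed
    ultimately show ?thesis by (simp only: diff_zero)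
  qed

  show ?thesis
    using H_mono H_rc H_bot H_top unfolding is_cdf_def A_def B_def by blast
qed

end
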